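(* Let $z^*$ be an optimal solution (global minimizer) of the problem $\min\{f(z):z\in F\}$. Then $z^*$ is a CW (coordinate-wise) minimum of this problem.
   Context: $l,m,n,s,t$ are positive integers with $s<m$, $t<n$; $\mathscr{A}=(a_{ijk})\in\mathbb{R}^{l\times m\times n}$ and $b\in\mathbb{R}^l$ are given. For $x\in\mathbb{R}^m$, $y\in\mathbb{R}^n$, $\mathscr{A}xy\in\mathbb{R}^l$ has entries $(\mathscr{A}xy)_i=\sum_{j,k}a_{ijk}x_jy_k$, and $f(z)=f(x,y)=\frac12\|\mathscr{A}xy-b\|^2$ for $z=(x,y)\in\mathbb{R}^{m+n}$. $I=\{1,\dots,m+n\}$, $I_1=\{1,\dots,m\}$, $I_2=\{m+1,\dots,m+n\}$; coordinates of $y$ are indexed by $I_2$. $e_i$ is the $i$-th standard basis vector of $\mathbb{R}^{m+n}$. $\|\cdot\|_0$ counts nonzero entries. For $x\ne0$, $\gamma_x$ is the index of the first nonzero entry of $x$. $F_1=\{x\in\mathbb{R}^m:\|x\|_0\le s,\ e_{\gamma_x}^\top x=1\}$ (nonzero vectors with at most $s$ nonzero entries and first nonzero entry equal to $1$), $F_2=\{y\in\mathbb{R}^n:\|y\|_0\le t\}$, $F=F_1\times F_2$. For $z^*=(x^*,y^* )$: $\Gamma^*=\{i\in I:z_i^*\ne0\}$, $\Gamma_1^*=\Gamma^*\cap I_1$, $\Gamma_2^*=\Gamma^*\cap I_2$. CW minimum: consider, for indices $i,j$, the conditions (a) $f(z^* )\le\min_{u\in\mathbb{R}}f(z^*-z_i^*e_i+ue_j)$;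 (b) $f(z^* )=\min_{u\in\mathbb{R}}f(z^*+ue_i)$. A point $z^*=(x^*,y^* )\in F$ is a CW minimum if the one of the following that applies to it holds: (i) $\|x^*\|_0=s$, $\|y^*\|_0=t$, and (a) holds for all $(i,j)\in (I_1\times I_1)\cup(I_2\times I_2)$ with $i\in\Gamma^*\setminus\{\gamma_{x^*}\}$ and $j>\gamma_{x^*}$; (ii) $\|x^*\|_0<s$, $\|y^*\|_0<t$, and (b) holds for all $i\in I$ with $i>\gamma_{x^*}$; (iii) $\|x^*\|_0=s$, $\|y^*\|_0<t$, (b) holds for all $i\in I_2$, and (a) holds for all $(i,j)\in I_1\times I_1$ with $i\in\Gamma_1^*\setminus\{\gamma_{x^*}\}$ and $j>\gamma_{x^*}$; (iv) $\|x^*\|_0<s$, $\|y^*\|_0=t$, (b) holds for all $i\in I_1$ with $i>\gamma_{x^*}$, and (a) holds for all $i\in\Gamma_2^*$ and $j\in I_2$. *)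

theory Defs
  imports "HOL-Analysis.Analysis"
begin

text \<open>
  The dimensions \<open>l, m, n\<close> are the cardinalities of the finite index types \<open>'l, 'm, 'n\<close>;
  the type \<open>'m\<close> carries a linear order, so that it is a copy of \<open>{1, \<dots>, m}\<close> and the first
  nonzero entry of a vector makes sense.  The space of all \<open>z = (x, y)\<close> is
  \<open>real ^ ('m + 'n)\<close>: the summand \<open>Inl\<close> indexes the coordinates of \<open>x\<close>, the summand \<open>Inr\<close>
  those of \<open>y\<close>.
\<close>

definition x_part :: "real ^ ('m::finite + 'n::finite) \<Rightarrow> real ^ 'm" where
  "x_part z = (\<chi> j. z $ Inl j)"

definition y_part :: "real ^ ('m::finite + 'n::finite) \<Rightarrow> real ^ 'n" where
  "y_part z = (\<chi> k. z $ Inr k)"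

definition tensor_app ::
  "real ^ 'n ^ 'm ^ 'l \<Rightarrow> real ^ 'm::finite \<Rightarrow> real ^ 'n::finite \<Rightarrow> real ^ 'l::finite" where
  "tensor_app A x y = (\<chi> i. \<Sum>j\<in>UNIV. \<Sum>k\<in>UNIV. A $ i $ j $ k * x $ j * y $ k)"

definition objective ::
  "real ^ 'n ^ 'm ^ 'l \<Rightarrow> real ^ 'l::finite \<Rightarrow> real ^ ('m::finite + 'n::finite) \<Rightarrow> real" where
  "objective A b z = 1 / 2 * (norm (tensor_app A (x_part z) (y_part z) - b))\<^sup>2"

definition l0_norm :: "real ^ 'k::finite \<Rightarrow> nat" where
  "l0_norm v = card {i. v $ i \<noteq> 0}"

text \<open>Only meaningful for \<open>x \<noteq> 0\<close>.\<close>

definition first_nz :: "real ^ 'm::{finite,linorder} \<Rightarrow> 'm" where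
  "first_nz x = Min {i. x $ i \<noteq> 0}"

definition F1 :: "nat \<Rightarrow> (real ^ 'm::{finite,linorder}) set" where
  "F1 s = {x. x \<noteq> 0 \<and> l0_norm x \<le> s \<and> axis (first_nz x) 1 \<bullet> x = 1}"

definition F2 :: "nat \<Rightarrow> (real ^ 'n::finite) set" where
  "F2 t = {y. l0_norm y \<le> t}"

definition feasible :: "nat \<Rightarrow> nat \<Rightarrow> (real ^ ('m::{finite,linorder} + 'n::finite)) set" where
  "feasible s t = {z. x_part z \<in> F1 s \<and> y_part z \<in> F2 t}"

definition I1 :: "('m + 'n) set" where
  "I1 = range Inl"

definition I2 :: "('m + 'n) set" where
  "I2 = range Inr"

text \<open>
  The order of \<open>{1, \<dots>, m + n}\<close>, needed only for comparing an index \<open>g\<close> of the first block with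
  an arbitrary index: every index of the second block is larger.
\<close>

definition index_gt :: "'m::linorder + 'n \<Rightarrow> 'm \<Rightarrow> bool" where
  "index_gt j g = (case j of Inl j' \<Rightarrow> g < j' | Inr _ \<Rightarrow> True)"

definition supp :: "real ^ 'k::finite \<Rightarrow> 'k set" where
  "supp z = {i. z $ i \<noteq> 0}"

text \<open>\<open>is_min_value g v\<close>: the minimum of \<open>g\<close> over the real line exists (is attained) and
  equals \<open>v\<close>.\<close>

definition is_min_value :: "(real \<Rightarrow> real) \<Rightarrow> real \<Rightarrow> bool" where
  "is_min_value g v \<longleftrightarrow> (\<exists>u. is_arg_min g (\<lambda>_. True) u \<and> v = g u)"

definition swap_cond :: "(real ^ 'k::finite \<Rightarrow> real) \<Rightarrow> real ^ 'k \<Rightarrow> 'k \<Rightarrow> 'k \<Rightarrow> bool" where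
  "swap_cond f z i j \<longleftrightarrow>
     (\<exists>v. is_min_value (\<lambda>u. f (z - (z $ i) *\<^sub>R axis i 1 + u *\<^sub>R axis j 1)) v \<and> f z \<le> v)"

definition coord_cond :: "(real ^ 'k::finite \<Rightarrow> real) \<Rightarrow> real ^ 'k \<Rightarrow> 'k \<Rightarrow> bool" where
  "coord_cond f z i \<longleftrightarrow> is_min_value (\<lambda>u. f (z + u *\<^sub>R axis i 1)) (f z)"

text \<open>The four alternatives are mutually exclusive and exhaust the feasible set.\<close>

definition CW_minimum ::
  "(real ^ ('m::{finite,linorder} + 'n::finite) \<Rightarrow> real) \<Rightarrow> nat \<Rightarrow> nat \<Rightarrow> real ^ ('m + 'n) \<Rightarrow> bool"
where
  "CW_minimum f s t z \<longleftrightarrow> z \<in> feasible s t \<and>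
    (let x = x_part z; y = y_part z; g = first_nz x;
         \<Gamma> = supp z; \<Gamma>1 = \<Gamma> \<inter> I1; \<Gamma>2 = \<Gamma> \<inter> I2
     in
       (l0_norm x = s \<and> l0_norm y = t \<and>
         (\<forall>(i, j) \<in> I1 \<times> I1 \<union> I2 \<times> I2.
            i \<in> \<Gamma> - {Inl g} \<and> index_gt j g \<longrightarrow> swap_cond f z i j))
     \<or> (l0_norm x < s \<and> l0_norm y < t \<and>
         (\<forall>i. index_gt i g \<longrightarrow> coord_cond f z i))
     \<or> (l0_norm x = s \<and> l0_norm y < t \<and>
         (\<forall>i \<in> I2. coord_cond f z i) \<and>
         (\<forall>(i, j) \<in> I1 \<times> I1.
            i \<in> \<Gamma>1 - {Inl g} \<and> index_gt j g \<longrightarrow> swap_cond f z i j))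
     \<or> (l0_norm x < s \<and> l0_norm y = t \<and>
         (\<forall>i \<in> I1. index_gt i g \<longrightarrow> coord_cond f z i) \<and>
         (\<forall>i \<in> \<Gamma>2. \<forall>j \<in> I2. swap_cond f z i j)))"

end

theory Submission
  imports Defs
begin

text \<open>
  Every comparison point \<open>w\<close> in the coordinate-wise conditions is again feasible.  Moving a
  coordinate in a block whose sparsity bound is slack creates at most one new nonzero entry, and
  transferring weight from a support index \<open>i\<close> to \<open>j\<close> creates at most one while destroying one.
  The normalization of \<open>x\<close> survives because only entries strictly behind its first nonzero entry
  change: \<open>j\<close> lies there by hypothesis, and \<open>i\<close> does because it is a support index other than the
  first one.  Hence global optimality of \<open>z\<close> gives \<open>f z \<le> f w\<close> for all these \<open>w\<close>.

  It remains to see that the minima over \<open>u\<close> exist.  Since \<open>tensor_app\<close> is bilinear and a single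
  coordinate belongs to only one of its arguments, the residual is affine in \<open>u\<close>, so that \<open>f\<close>
  restricted to the line is half the squared norm of \<open>p + u *\<^sub>R q\<close>; such a function attains its
  minimum on the real line.
\<close>

lemma x_part_simps [simp]:
  "x_part (v + w) = x_part v + x_part w"
  "x_part (v - w) = x_part v - x_part w"
  "x_part (c *\<^sub>R v) = c *\<^sub>R x_part v"
  "x_part (axis (Inl i) 1) = axis i 1"
  "x_part (axis (Inr k) 1) = 0"
  by (simp_all add: x_part_def vec_eq_iff axis_def)

lemma y_part_simps [simp]:
  "y_part (v + w) = y_part v + y_part w"
  "y_part (v - w) = y_part v - y_part w"
  "y_part (c *\<^sub>R v) = c *\<^sub>R y_part v"
  "y_part (axis (Inl i) 1) = 0"
  "y_part (axis (Inr k) 1) = axis k 1"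
  by (simp_all add: y_part_def vec_eq_iff axis_def)

lemma tensor_app_line_left:
  "tensor_app A (x + u *\<^sub>R x') y = tensor_app A x y + u *\<^sub>R tensor_app A x' y"
  by (simp add: tensor_app_def vec_eq_iff sum.distrib sum_distrib_left algebra_simps)

lemma tensor_app_line_right:
  "tensor_app A x (y + u *\<^sub>R y') = tensor_app A x y + u *\<^sub>R tensor_app A x y'"
  by (simp add: tensor_app_def vec_eq_iff sum.distrib sum_distrib_left algebra_simps)

text \<open>
  In a general direction the bilinear term contributes \<open>u\<^sup>2\<close> to the residual; in a coordinate
  direction one factor stays constant, so the residual is affine in \<open>u\<close>.
\<close>

lemma objective_along_axis:
  fixes b :: "real ^ 'l::finite"
  shows "\<exists>p q :: real ^ 'l. \<forall>u. objective A b (w + u *\<^sub>R axis j 1) = 1 / 2 * (norm (p + u *\<^sub>R q))\<^sup>2"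
proof (cases j)
  case (Inl i)
  show ?thesis
    by (rule exI[of _ "tensor_app A (x_part w) (y_part w) - b"],
        rule exI[of _ "tensor_app A (axis i 1) (y_part w)"])
       (simp add: objective_def Inl tensor_app_line_left algebra_simps)
next
  case (Inr k)
  show ?thesis
    by (rule exI[of _ "tensor_app A (x_part w) (y_part w) - b"],
        rule exI[of _ "tensor_app A (x_part w) (axis k 1)"])
       (simp add: objective_def Inr tensor_app_line_right algebra_simps)
qed

text \<open>
  The minimizer is the foot of the perpendicular from the origin to the line; for \<open>q = 0\<close>
  the formula gives \<open>u = 0\<close>, which is as good as any point.
\<close>

lemma nearest_point_on_line:
  fixes p q :: "'a::real_inner"
  shows "norm (p + (- (p \<bullet> q) / (q \<bullet> q)) *\<^sub>R q) \<le> norm (p + u *\<^sub>R q)"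
proof -
  define c where "c = - (p \<bullet> q) / (q \<bullet> q)"
  have orth: "(p + c *\<^sub>R q) \<bullet> q = 0"
    by (cases "q = 0") (simp_all add: c_def inner_add_left inner_diff_left)
  have "(norm (p + u *\<^sub>R q))\<^sup>2 = (norm ((p + c *\<^sub>R q) + (u - c) *\<^sub>R q))\<^sup>2"
    by (simp add: algebra_simps)
  also have "\<dots> = (norm (p + c *\<^sub>R q))\<^sup>2 + (norm ((u - c) *\<^sub>R q))\<^sup>2"
    by (rule norm_add_Pythagorean) (simp add: orthogonal_def orth)
  finally have "(norm (p + c *\<^sub>R q))\<^sup>2 \<le> (norm (p + u *\<^sub>R q))\<^sup>2"
    by simp
  then show ?thesis
    by (simp add: c_def)
qed

lemma objective_attains_min_along_axis:
  fixes b :: "real ^ 'l::finite"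
  shows "\<exists>u. is_arg_min (\<lambda>u. objective A b (w + u *\<^sub>R axis j 1)) (\<lambda>_. True) u"
proof -
  obtain p q :: "real ^ 'l" where pq: "\<And>u. objective A b (w + u *\<^sub>R axis j 1) = 1 / 2 * (norm (p + u *\<^sub>R q))\<^sup>2"
    using objective_along_axis[of A b w j] by blast
  show ?thesis
    by (rule exI[of _ "- (p \<bullet> q) / (q \<bullet> q)"])
       (simp add: is_arg_min_linorder pq power_mono nearest_point_on_line del: divide_minus_left)
qed

lemma swap_cond_objectiveI:
  assumes "\<And>u. objective A b z \<le> objective A b (z - (z $ i) *\<^sub>R axis i 1 + u *\<^sub>R axis j 1)"
  shows "swap_cond (objective A b) z i j"
  using objective_attains_min_along_axis[of A b "z - (z $ i) *\<^sub>R axis i 1" j] assms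
  unfolding swap_cond_def is_min_value_def by blast

lemma coord_condI:
  assumes "\<And>u. f z \<le> f (z + u *\<^sub>R axis i 1)"
  shows "coord_cond f z i"
  unfolding coord_cond_def is_min_value_def
  by (rule exI[of _ 0]) (simp add: is_arg_min_linorder assms)

lemma l0_norm_add_axis: "l0_norm (v + u *\<^sub>R axis j 1) \<le> Suc (l0_norm v)"
proof -
  have "{k. (v + u *\<^sub>R axis j 1) $ k \<noteq> 0} \<subseteq> insert j {k. v $ k \<noteq> 0}"
    by (auto simp: axis_def)
  then have "l0_norm (v + u *\<^sub>R axis j 1) \<le> card (insert j {k. v $ k \<noteq> 0})"
    unfolding l0_norm_def by (rule card_mono[rotated]) simp
  also have "\<dots> \<le> Suc (l0_norm v)"
    unfolding l0_norm_def by (rule card_insert_le_m1) simp_all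
  finally show ?thesis .
qed

lemma l0_norm_swap:
  assumes "v $ i \<noteq> 0"
  shows "l0_norm (v - (v $ i) *\<^sub>R axis i 1 + u *\<^sub>R axis j 1) \<le> l0_norm v"
proof -
  have "{k. (v - (v $ i) *\<^sub>R axis i 1) $ k \<noteq> 0} = {k. v $ k \<noteq> 0} - {i}"
    by (auto simp: axis_def)
  then have "Suc (l0_norm (v - (v $ i) *\<^sub>R axis i 1)) = l0_norm v"
    using assms unfolding l0_norm_def by (simp only:, intro card_Suc_Diff1) simp_all
  with l0_norm_add_axis[of "v - (v $ i) *\<^sub>R axis i 1" u j] show ?thesis
    by simp
qed

lemma first_nz_le: "x $ i \<noteq> 0 \<Longrightarrow> first_nz x \<le> i"
  by (simp add: first_nz_def)

lemma first_nz_eqI: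
  assumes "x $ g \<noteq> 0" and "\<And>k. k < g \<Longrightarrow> x $ k = 0"
  shows "first_nz x = g"
  unfolding first_nz_def by (rule Min_eqI) (use assms in \<open>auto intro: leI\<close>)

text \<open>
  Membership in \<open>F1\<close> constrains the entries only up to the first nonzero one, apart from
  their number.
\<close>

lemma F1_change_behind_first_nz:
  assumes "x \<in> F1 s" and eq: "\<And>k. k \<le> first_nz x \<Longrightarrow> x' $ k = x $ k" and "l0_norm x' \<le> s"
  shows "x' \<in> F1 s"
proof -
  have one: "x' $ first_nz x = 1"
    using assms(1) eq[of "first_nz x"] by (simp add: F1_def inner_axis')
  have "first_nz x' = first_nz x"
  proof (rule first_nz_eqI)
    fix k assume "k < first_nz x"
    then show "x' $ k = 0"
      using first_nz_le[of x k] eq[of k] by force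
  qed (simp add: one)
  moreover have "x' \<noteq> 0"
    using one by auto
  ultimately show ?thesis
    using one assms(3) by (simp add: F1_def inner_axis')
qed

theorem theorem3p11:
  fixes A :: "real ^ 'n::finite ^ 'm::{finite,linorder} ^ 'l::finite"
    and b :: "real ^ 'l"
    and s t :: nat
    and z :: "real ^ ('m + 'n)"
  assumes "0 < s" and "s < CARD('m)"
    and "0 < t" and "t < CARD('n)"
    and "is_arg_min (objective A b) (\<lambda>w. w \<in> feasible s t) z"
  shows "CW_minimum (objective A b) s t z"
proof -
  define g where "g = first_nz (x_part z)"
  have feas: "z \<in> feasible s t"
    and opt: "\<And>w. w \<in> feasible s t \<Longrightarrow> objective A b z \<le> objective A b w"
    using assms(5) by (auto simp: is_arg_min_linorder)
  have x: "x_part z \<in> F1 s" and y: "y_part z \<in> F2 t"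
    using feas by (auto simp: feasible_def)
  have xs: "l0_norm (x_part z) \<le> s" and yt: "l0_norm (y_part z) \<le> t"
    using x y by (auto simp: F1_def F2_def)
  have zl: "z $ Inl i = x_part z $ i" for i
    by (simp add: x_part_def)
  have zr: "z $ Inr k = y_part z $ k" for k
    by (simp add: y_part_def)

  have swap_x: "swap_cond (objective A b) z (Inl i) (Inl j)"
    if "z $ Inl i \<noteq> 0" "i \<noteq> g" "g < j" for i j
  proof (rule swap_cond_objectiveI, rule opt)
    fix u
    have nz: "x_part z $ i \<noteq> 0"
      using that(1) by (simp add: zl)
    have "g < i"
      using first_nz_le[OF nz] that(2) by (simp add: g_def)
    then have "x_part z - (x_part z $ i) *\<^sub>R axis i 1 + u *\<^sub>R axis j 1 \<in> F1 s"
      using that(3) xs l0_norm_swap[OF nz, of u j]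
      by (intro F1_change_behind_first_nz[OF x]) (auto simp: axis_def g_def)
    then show "z - (z $ Inl i) *\<^sub>R axis (Inl i) 1 + u *\<^sub>R axis (Inl j) 1 \<in> feasible s t"
      using y by (simp add: feasible_def zl)
  qed

  have swap_y: "swap_cond (objective A b) z (Inr i) (Inr j)" if "z $ Inr i \<noteq> 0" for i j
  proof (rule swap_cond_objectiveI, rule opt)
    fix u
    show "z - (z $ Inr i) *\<^sub>R axis (Inr i) 1 + u *\<^sub>R axis (Inr j) 1 \<in> feasible s t"
      using x yt l0_norm_swap[of "y_part z" i u j] that by (simp add: feasible_def F2_def zr)
  qed

  have coord_x: "coord_cond (objective A b) z (Inl i)"
    if "l0_norm (x_part z) < s" "g < i" for i
  proof (rule coord_condI, rule opt)
    fix u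
    have "x_part z + u *\<^sub>R axis i 1 \<in> F1 s"
      using that l0_norm_add_axis[of "x_part z" u i]
      by (intro F1_change_behind_first_nz[OF x]) (auto simp: axis_def g_def)
    then show "z + u *\<^sub>R axis (Inl i) 1 \<in> feasible s t"
      using y by (simp add: feasible_def)
  qed

  have coord_y: "coord_cond (objective A b) z (Inr k)" if "l0_norm (y_part z) < t" for k
  proof (rule coord_condI, rule opt)
    fix u
    show "z + u *\<^sub>R axis (Inr k) 1 \<in> feasible s t"
      using x that l0_norm_add_axis[of "y_part z" u k] by (simp add: feasible_def F2_def)
  qed

  have coord: "coord_cond (objective A b) z i"
    if "l0_norm (x_part z) < s" "l0_norm (y_part z) < t" "index_gt i g" for i
    using that coord_x coord_y by (cases i) (auto simp: index_gt_def)

  consider "l0_norm (x_part z) = s" "l0_norm (y_part z) = t"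
    | "l0_norm (x_part z) < s" "l0_norm (y_part z) < t"
    | "l0_norm (x_part z) = s" "l0_norm (y_part z) < t"
    | "l0_norm (x_part z) < s" "l0_norm (y_part z) = t"
    using xs yt by linarith
  then show ?thesis
    unfolding CW_minimum_def Let_def g_def[symmetric]
    using feas
    by cases (auto simp: I1_def I2_def supp_def intro: coord,
        auto simp: index_gt_def intro: swap_x swap_y coord_x coord_y)
qed

end
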